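(* Let $X$ be a spectrally negative L\'evy process with scale functions $W^{(\cdot)}$. Let $n\ge1$, let $p_0,p_1,\dots,p_n\ge0$ and $x_1\le x_2\le\cdots\le x_n$ be real numbers, and let $$\omega(x)=p_0+\sum_{j=1}^n(p_j-p_{j-1})\mathbf{1}(x>x_j).$$ Define $\mathcal{W}_0(x,y)=W^{(p_0)}(x-y)$ and, recursively for $k=0,\dots,n-1$, $$\mathcal{W}_{k+1}(x,y)=\mathcal{W}_k(x,y)+(p_{k+1}-p_k)\int_{x_{k+1}}^xW^{(p_{k+1})}(x-z)\,\mathcal{W}_k(z,y)\,dz.$$ Then $\mathcal{W}^{(\omega)}(x,y)=\mathcal{W}_n(x,y)$ for all $x,y\in\mathbb{R}$.
   Context: $X=\{X_t,t\ge 0\}$ is a spectrally negative L\'evy process (a c\`adl\`ag process with stationary independent increments and no positive jumps) that is not the negative of a subordinator. Its Laplace exponent $\psi$, defined by $\mathbb{E}[e^{\theta X_t}]=e^{t\psi(\theta)}$ for $\theta\ge 0$ (with $X_0=0$), is continuous and strictly convex on $[0,\infty)$ and tends to $\infty$ at $\infty$. $\Phi(\theta)=\inf\{s>0:\psi(s)>\theta\}$, $\theta\ge0$. For $q\ge 0$ the scale function $W^{(q)}:\mathbb{R}\to[0,\infty)$ vanishes on $(-\infty,0)$, is continuous and increasing on $[0,\infty)$, and satisfies $\int_0^\infty e^{-\theta y}W^{(q)}(y)\,dy=1/(\psi(\theta)-q)$ for $\theta>\Phi(q)$. $W:=W^{(0)}$. For each $y\in\mathbb{R}$, $\mathcal{W}^{(\omega)}(\cdot,y)$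 is the unique locally bounded function on $\mathbb{R}$ satisfying $\mathcal{W}^{(\omega)}(x,y)=W(x-y)+\int_y^x W(x-z)\omega(z)\mathcal{W}^{(\omega)}(z,y)\,dz$ (so $\mathcal{W}^{(\omega)}(x,y)=0$ for $x<y$). The integral $\int_{x_{k+1}}^x$ is zero when $x<x_{k+1}$, because the scale functions vanish on $(-\infty,0)$. *)

theory Defs
  imports "HOL-Probability.Probability"
begin

definition cadlag_path :: "(real \<Rightarrow> real) \<Rightarrow> bool" where
  "cadlag_path f \<longleftrightarrow>
     (\<forall>t\<ge>0. (f \<longlongrightarrow> f t) (at_right t)) \<and>
     (\<forall>t>0. \<exists>l. (f \<longlongrightarrow> l) (at_left t))"

definition no_positive_jumps :: "(real \<Rightarrow> real) \<Rightarrow> bool" where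
  "no_positive_jumps f \<longleftrightarrow> (\<forall>t>0. \<forall>l. (f \<longlongrightarrow> l) (at_left t) \<longrightarrow> f t \<le> l)"

text \<open>Processes are indexed by all reals, but only the times \<open>t \<ge> 0\<close> are ever constrained or used.\<close>

definition levy_process :: "'a measure \<Rightarrow> (real \<Rightarrow> 'a \<Rightarrow> real) \<Rightarrow> bool" where
  "levy_process M X \<longleftrightarrow>
     prob_space M \<and>
     (\<forall>t\<ge>0. X t \<in> borel_measurable M) \<and>
     (AE w in M. X 0 w = 0) \<and>
     (AE w in M. cadlag_path (\<lambda>t. X t w)) \<and>
     (\<forall>s t. 0 \<le> s \<and> s \<le> t \<longrightarrow>
        distr M borel (\<lambda>w. X t w - X s w) = distr M borel (X (t - s))) \<and>
     (\<forall>(n::nat) t. 0 \<le> t 0 \<and> mono_on {..n} t \<longrightarrow>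
        prob_space.indep_vars M (\<lambda>_. borel) (\<lambda>i w. X (t (Suc i)) w - X (t i) w) {..<n})"

definition subordinator :: "'a measure \<Rightarrow> (real \<Rightarrow> 'a \<Rightarrow> real) \<Rightarrow> bool" where
  "subordinator M X \<longleftrightarrow>
     levy_process M X \<and> (AE w in M. mono_on {0..} (\<lambda>t. X t w))"

definition spectrally_negative_levy :: "'a measure \<Rightarrow> (real \<Rightarrow> 'a \<Rightarrow> real) \<Rightarrow> bool" where
  "spectrally_negative_levy M X \<longleftrightarrow>
     levy_process M X \<and>
     (AE w in M. no_positive_jumps (\<lambda>t. X t w)) \<and>
     \<not> subordinator M (\<lambda>t w. - X t w)"

text \<open>
  The right-hand side below is nonzero, so the equation forces \<open>exp (\<theta> * X t)\<close> to be
  integrable (the Bochner integral of a non-integrable function is 0). It determines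
  \<open>\<psi>\<close> uniquely on the half-line \<open>\<theta> \<ge> 0\<close>, the only place where it is used.
\<close>

definition is_laplace_exponent ::
    "'a measure \<Rightarrow> (real \<Rightarrow> 'a \<Rightarrow> real) \<Rightarrow> (real \<Rightarrow> real) \<Rightarrow> bool" where
  "is_laplace_exponent M X \<psi> \<longleftrightarrow>
     (\<forall>\<theta>\<ge>0. \<forall>t\<ge>0. prob_space.expectation M (\<lambda>w. exp (\<theta> * X t w)) = exp (t * \<psi> \<theta>))"

definition right_inverse :: "(real \<Rightarrow> real) \<Rightarrow> real \<Rightarrow> real" where
  "right_inverse \<psi> \<theta> = Inf {s. s > 0 \<and> \<psi> s > \<theta>}"

definition is_scale_function :: "(real \<Rightarrow> real) \<Rightarrow> real \<Rightarrow> (real \<Rightarrow> real) \<Rightarrow> bool" where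
  "is_scale_function \<psi> q W \<longleftrightarrow>
     (\<forall>x. 0 \<le> W x) \<and>
     (\<forall>x<0. W x = 0) \<and>
     continuous_on {0..} W \<and>
     mono_on {0..} W \<and>
     (\<forall>\<theta>>right_inverse \<psi> q.
        set_integrable lborel {0..} (\<lambda>y. exp (- \<theta> * y) * W y) \<and>
        (LINT y:{0..}|lborel. exp (- \<theta> * y) * W y) = 1 / (\<psi> \<theta> - q))"

definition locally_bounded :: "(real \<Rightarrow> real) \<Rightarrow> bool" where
  "locally_bounded f \<longleftrightarrow> (\<forall>a b. bounded (f ` {a..b}))"

text \<open>
  Measurability is implicit in the integral equation on paper; it has to be explicit here
  because the Bochner integral of a non-measurable function is 0 rather than undefined.
  For \<open>x < y\<close> the interval \<open>{y..x}\<close> is empty; since \<open>W\<close> vanishes on the negative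
  half-line, this agrees with the oriented integral.
\<close>

definition omega_scale_equation ::
    "(real \<Rightarrow> real) \<Rightarrow> (real \<Rightarrow> real) \<Rightarrow> real \<Rightarrow> (real \<Rightarrow> real) \<Rightarrow> bool" where
  "omega_scale_equation W \<omega> y f \<longleftrightarrow>
     f \<in> borel_measurable borel \<and> locally_bounded f \<and>
     (\<forall>x. f x = W (x - y) + (LINT z:{y..x}|lborel. W (x - z) * \<omega> z * f z))"

definition omega_scale ::
    "(real \<Rightarrow> real) \<Rightarrow> (real \<Rightarrow> real) \<Rightarrow> real \<Rightarrow> real \<Rightarrow> real" where
  "omega_scale W \<omega> x y = (THE f. omega_scale_equation W \<omega> y f) x"

definition step_rate :: "nat \<Rightarrow> (nat \<Rightarrow> real) \<Rightarrow> (nat \<Rightarrow> real) \<Rightarrow> real \<Rightarrow> real" where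
  "step_rate n p \<xi> x = p 0 + (\<Sum>j=1..n. (p j - p (j - 1)) * indicator {\<xi> j<..} x)"

primrec iterated_scale ::
    "(real \<Rightarrow> real \<Rightarrow> real) \<Rightarrow> (nat \<Rightarrow> real) \<Rightarrow> (nat \<Rightarrow> real) \<Rightarrow> nat \<Rightarrow> real \<Rightarrow> real \<Rightarrow> real" where
  "iterated_scale W p \<xi> 0 x y = W (p 0) (x - y)"
| "iterated_scale W p \<xi> (Suc k) x y =
     iterated_scale W p \<xi> k x y +
     (p (Suc k) - p k) *
       (LINT z:{\<xi> (Suc k)..x}|lborel. W (p (Suc k)) (x - z) * iterated_scale W p \<xi> k z y)"

end

(*
  Write W_q for the q-scale function and * for convolution of functions that vanish far to the left.
  Since the Laplace transform 1 / (psi - q) determines W_q, one has the resolvent identity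
  W_q - W_0 = q W_0 * W_q. Suppose f = W_0(. - y) + W_0 * (omega f) with omega = p on (xi, oo), and
  let the rate jump from p to q at xi. With h = f 1_(xi, oo) the function F = f + (q - p) W_q * h
  solves the equation for the new rate: the right-hand side changes by
  (q - p) (W_0 * h + q W_0 * W_q * h), which by the resolvent identity is (q - p) W_q * h.
  Uniqueness of the solution of the Volterra equation is the usual Gronwall iteration.
*)

theory Submission
  imports Defs
begin

section \<open>Convolution of causal functions\<close>

text \<open>Integrating over the whole line leaves no endpoints to track in Fubini and translation
  arguments; for causal factors the integrand has bounded support anyway.\<close>

definition conv :: "(real \<Rightarrow> real) \<Rightarrow> (real \<Rightarrow> real) \<Rightarrow> real \<Rightarrow> real" where
  "conv u v x = (LINT z|lborel. u (x - z) * v z)"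

text \<open>The working class for the Volterra equation: a left cutoff plus local boundedness bounds
  \<open>f\<close> on every half-line ending at some \<open>b\<close>, so convolutions converge
  absolutely. The class is closed under sums, locally bounded factors, shifts and convolution, with
  cutoffs adding under convolution.\<close>

definition causal_from :: "real \<Rightarrow> (real \<Rightarrow> real) \<Rightarrow> bool" where
  "causal_from a f \<longleftrightarrow> f \<in> borel_measurable borel \<and> locally_bounded f \<and> (\<forall>x<a. f x = 0)"

section \<open>Local bounds and closure properties of causal functions\<close>

lemma locally_boundedI:
  assumes "\<And>b. \<exists>B. \<forall>x. \<bar>x\<bar> \<le> b \<longrightarrow> \<bar>f x\<bar> \<le> B"
  shows "locally_bounded f"
  unfolding locally_bounded_def
proof (intro allI)
  fix a b :: real
  obtain B where "\<forall>x. \<bar>x\<bar> \<le> max \<bar>a\<bar> \<bar>b\<bar> \<longrightarrow> \<bar>f x\<bar> \<le> B" using assms by blast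
  moreover have "\<bar>x\<bar> \<le> max \<bar>a\<bar> \<bar>b\<bar>" if "x \<in> {a..b}" for x using that by auto
  ultimately have "\<forall>x\<in>{a..b}. \<bar>f x\<bar> \<le> B" by blast
  then show "bounded (f ` {a..b})" by (auto simp: bounded_iff)
qed

lemma locally_boundedE:
  assumes "locally_bounded f"
  obtains B where "B \<ge> 0" "\<And>x. a \<le> x \<Longrightarrow> x \<le> b \<Longrightarrow> \<bar>f x\<bar> \<le> B"
proof -
  obtain B where "\<forall>x\<in>{a..b}. \<bar>f x\<bar> \<le> B"
    using assms unfolding locally_bounded_def bounded_iff by fastforce
  then show ?thesis by (intro that[of "max 0 B"]) (auto simp: le_max_iff_disj)
qed

lemma causal_from_measurable: "causal_from a f \<Longrightarrow> f \<in> borel_measurable borel"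
  by (simp add: causal_from_def)

lemma causal_from_zero: "causal_from a f \<Longrightarrow> x < a \<Longrightarrow> f x = 0"
  by (simp add: causal_from_def)

lemma causal_from_bound:
  assumes "causal_from a f"
  obtains B where "B \<ge> 0" "\<And>x. x \<le> b \<Longrightarrow> \<bar>f x\<bar> \<le> B"
proof -
  obtain B where B: "B \<ge> 0" "\<And>x. a \<le> x \<Longrightarrow> x \<le> b \<Longrightarrow> \<bar>f x\<bar> \<le> B"
    using assms locally_boundedE[of f a b] unfolding causal_from_def by metis
  have "\<bar>f x\<bar> \<le> B" if "x \<le> b" for x
    using B causal_from_zero[OF assms, of x] that by (cases "x < a") auto
  with B(1) show ?thesis by (rule that)
qed

lemma causal_fromI:
  assumes "f \<in> borel_measurable borel" "\<And>x. x < a \<Longrightarrow> f x = 0"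
    and "\<And>b. \<exists>B. \<forall>x\<le>b. \<bar>f x\<bar> \<le> B"
  shows "causal_from a f"
  unfolding causal_from_def
proof (intro conjI)
  show "locally_bounded f"
    by (rule locally_boundedI) (metis abs_le_D1 assms(3))
qed (use assms in auto)

lemma causal_from_add:
  assumes "causal_from a f" "causal_from a g"
  shows "causal_from a (\<lambda>x. f x + g x)"
proof (rule causal_fromI)
  note [measurable] = assms[THEN causal_from_measurable]
  show "(\<lambda>x. f x + g x) \<in> borel_measurable borel" by measurable
  fix b
  obtain B C where "\<And>x. x \<le> b \<Longrightarrow> \<bar>f x\<bar> \<le> B" "\<And>x. x \<le> b \<Longrightarrow> \<bar>g x\<bar> \<le> C"
    using assms[THEN causal_from_bound] by metis
  then have "\<forall>x\<le>b. \<bar>f x + g x\<bar> \<le> B + C" by (meson abs_triangle_ineq add_mono order_trans)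
  then show "\<exists>B. \<forall>x\<le>b. \<bar>f x + g x\<bar> \<le> B" by blast
qed (simp add: assms[THEN causal_from_zero])

lemma causal_from_mult:
  assumes f: "causal_from a f" and g: "g \<in> borel_measurable borel" "locally_bounded g"
  shows "causal_from a (\<lambda>x. g x * f x)"
proof (rule causal_fromI)
  note [measurable] = f[THEN causal_from_measurable] g(1)
  show "(\<lambda>x. g x * f x) \<in> borel_measurable borel" by measurable
  show zero: "g x * f x = 0" if "x < a" for x using that causal_from_zero[OF f] by simp
  fix b
  obtain B where B: "B \<ge> 0" "\<And>x. x \<le> b \<Longrightarrow> \<bar>f x\<bar> \<le> B"
    using causal_from_bound[OF f] by metis
  obtain C where C: "C \<ge> 0" "\<And>x. a \<le> x \<Longrightarrow> x \<le> b \<Longrightarrow> \<bar>g x\<bar> \<le> C"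
    using locally_boundedE[OF g(2)] by metis
  have "\<bar>g x * f x\<bar> \<le> C * B" if "x \<le> b" for x
  proof (cases "x < a")
    case True
    then show ?thesis using zero[of x] B(1) C(1) by (metis abs_zero mult_nonneg_nonneg)
  next
    case False
    then show ?thesis using that C(1) by (auto simp: abs_mult intro!: mult_mono B C)
  qed
  then show "\<exists>B. \<forall>x\<le>b. \<bar>g x * f x\<bar> \<le> B" by blast
qed

lemma causal_from_cmult: "causal_from a f \<Longrightarrow> causal_from a (\<lambda>x. c * f x)"
  by (rule causal_from_mult) (auto intro: locally_boundedI)

lemma causal_from_shift:
  assumes "causal_from a f"
  shows "causal_from (a + y) (\<lambda>x. f (x - y))"
proof (rule causal_fromI)
  note [measurable] = assms[THEN causal_from_measurable]
  show "(\<lambda>x. f (x - y)) \<in> borel_measurable borel" by measurable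
  fix b
  obtain B where "\<And>x. x \<le> b - y \<Longrightarrow> \<bar>f x\<bar> \<le> B" using causal_from_bound[OF assms] by metis
  then show "\<exists>B. \<forall>x\<le>b. \<bar>f (x - y)\<bar> \<le> B" by (meson diff_right_mono)
qed (use causal_from_zero[OF assms] in auto)

text \<open>The majorant does not depend on \<open>x\<close> as long as \<open>x \<le> b\<close>. It
  therefore yields integrability, local boundedness of \<open>conv u v\<close> and, later, dominated
  convergence.\<close>

lemma conv_bound:
  assumes u: "causal_from a u" and v: "causal_from c v"
  obtains B where "B \<ge> 0"
    "\<And>x z. x \<le> b \<Longrightarrow> \<bar>u (x - z) * v z\<bar> \<le> B * indicator {c..b - a} z"
proof -
  \<comment> \<open>A nonzero integrand needs \<open>z \<ge> c\<close> and
    \<open>x - z \<ge> a\<close>, hence \<open>x - z \<le> b - c\<close> and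
    \<open>z \<le> b - a\<close>.\<close>
  obtain B where B: "B \<ge> 0" "\<And>x. x \<le> b - c \<Longrightarrow> \<bar>u x\<bar> \<le> B"
    using causal_from_bound[OF u] by metis
  obtain C where C: "C \<ge> 0" "\<And>x. x \<le> b - a \<Longrightarrow> \<bar>v x\<bar> \<le> C"
    using causal_from_bound[OF v] by metis
  have "\<bar>u (x - z) * v z\<bar> \<le> B * C * indicator {c..b - a} z" if "x \<le> b" for x z
  proof (cases "z < c \<or> x - z < a")
    case True
    then show ?thesis using B(1) C(1) causal_from_zero[OF u] causal_from_zero[OF v] by auto
  next
    case False
    then show ?thesis using that B(1) C(1) by (auto simp: abs_mult intro!: mult_mono B C)
  qed
  moreover have "B * C \<ge> 0" using B C by simp
  ultimately show ?thesis using that by blast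
qed

lemma integrable_indicator_Icc: "integrable lborel (\<lambda>z::real. B * indicator {a..b} z :: real)"
  by (intro integrable_mult_right) (simp add: integrable_indicator_iff emeasure_lborel_Icc_eq)

lemma conv_integrable:
  assumes u: "causal_from a u" and v: "causal_from c v"
  shows "integrable lborel (\<lambda>z. u (x - z) * v z)"
proof -
  note [measurable] = assms[THEN causal_from_measurable]
  obtain B where B: "B \<ge> 0"
    "\<And>x' z. x' \<le> x \<Longrightarrow> \<bar>u (x' - z) * v z\<bar> \<le> B * indicator {c..x - a} z"
    using conv_bound[OF u v] by metis
  show ?thesis
  proof (rule Bochner_Integration.integrable_bound[OF integrable_indicator_Icc[of B c "x - a"]])
    show "(\<lambda>z. u (x - z) * v z) \<in> borel_measurable lborel" by measurable
    show "AE z in lborel. norm (u (x - z) * v z) \<le> norm (B * indicator {c..x - a} z)"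
      using B(2)[OF order.refl] B(1) by (auto simp: abs_mult)
  qed
qed

lemma causal_from_conv:
  assumes u: "causal_from a u" and v: "causal_from c v"
  shows "causal_from (a + c) (conv u v)"
proof (rule causal_fromI)
  note [measurable] = assms[THEN causal_from_measurable]
  show "conv u v \<in> borel_measurable borel"
    unfolding conv_def[abs_def] by measurable
  show "conv u v x = 0" if "x < a + c" for x
  proof -
    have "(\<lambda>z. u (x - z) * v z) = (\<lambda>z. 0)"
    proof
      fix z show "u (x - z) * v z = 0"
        using that causal_from_zero[OF u, of "x - z"] causal_from_zero[OF v, of z] by (cases "z < c") auto
    qed
    then show ?thesis by (simp add: conv_def)
  qed
  fix b
  obtain B where B: "B \<ge> 0"
    "\<And>x z. x \<le> b \<Longrightarrow> \<bar>u (x - z) * v z\<bar> \<le> B * indicator {c..b - a} z"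
    using conv_bound[OF u v] by metis
  have "\<bar>conv u v x\<bar> \<le> (LINT z|lborel. B * indicator {c..b - a} z)" if "x \<le> b" for x
    unfolding conv_def real_norm_def[symmetric]
    by (rule Bochner_Integration.integral_norm_bound_integral[OF conv_integrable[OF u v] integrable_indicator_Icc])
       (use B(2)[OF that] in auto)
  then show "\<exists>B. \<forall>x\<le>b. \<bar>conv u v x\<bar> \<le> B" by blast
qed

section \<open>Bilinearity, translation and associativity of convolution\<close>

lemma conv_add_right:
  assumes "causal_from a u" "causal_from c v" "causal_from c w"
  shows "conv u (\<lambda>z. v z + w z) x = conv u v x + conv u w x"
  unfolding conv_def distrib_left
  by (rule Bochner_Integration.integral_add[OF conv_integrable conv_integrable]) (fact assms)+

lemma conv_cmult_right: "conv u (\<lambda>z. k * v z) x = k * conv u v x"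
  unfolding conv_def by (simp add: mult.left_commute[of _ k])

lemma conv_diff_left:
  assumes "causal_from a u" "causal_from a v" "causal_from c w"
  shows "conv (\<lambda>z. u z - v z) w x = conv u w x - conv v w x"
  unfolding conv_def left_diff_distrib
  by (rule Bochner_Integration.integral_diff[OF conv_integrable conv_integrable]) (fact assms)+

lemma conv_cmult_left: "conv (\<lambda>z. k * u z) v x = k * conv u v x"
  unfolding conv_def by (simp add: mult.assoc)

lemma conv_shift_right: "conv u (\<lambda>z. v (z - y)) x = conv u v (x - y)"
  unfolding conv_def
  by (subst lborel_integral_real_affine[of 1 _ y]) (simp_all add: algebra_simps)

text \<open>Fubini applies because the double integrand is bounded and supported in a compact
  square; translating the inner integral by \<open>s\<close> then produces
  \<open>conv u v (x - s)\<close>.\<close>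

lemma conv_assoc:
  assumes u: "causal_from 0 u" and v: "causal_from 0 v" and w: "causal_from c w"
  shows "conv u (conv v w) x = conv (conv u v) w x"
proof -
  note [measurable] = assms[THEN causal_from_measurable]
  obtain A B C where A: "A \<ge> 0" "\<And>t. t \<le> x - c \<Longrightarrow> \<bar>u t\<bar> \<le> A"
    and B: "B \<ge> 0" "\<And>t. t \<le> x - c \<Longrightarrow> \<bar>v t\<bar> \<le> B"
    and C: "C \<ge> 0" "\<And>t. t \<le> x \<Longrightarrow> \<bar>w t\<bar> \<le> C"
    using assms[THEN causal_from_bound] by metis
  let ?f = "\<lambda>z s. u (x - z) * (v (z - s) * w s)"
  \<comment> \<open>Unless \<open>c \<le> s \<le> z \<le> x\<close>, one of the three factors
    vanishes; in that range \<open>x - z\<close> and \<open>z - s\<close> are at most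
    \<open>x - c\<close>.\<close>
  have bound: "\<bar>?f z s\<bar> \<le> A * (B * C) * indicator ({c..x} \<times> {c..x}) (z, s)" for z s
  proof (cases "x - z < 0 \<or> z - s < 0 \<or> s < c")
    case True
    then show ?thesis
      using A(1) B(1) C(1) causal_from_zero[OF u] causal_from_zero[OF v] causal_from_zero[OF w] by auto
  next
    case False
    then show ?thesis unfolding abs_mult
      using A(1) B(1) C(1) by (auto intro!: mult_mono A B C)
  qed
  have "integrable (lborel \<Otimes>\<^sub>M lborel) (case_prod ?f)"
  proof (rule Bochner_Integration.integrable_bound)
    show "integrable (lborel \<Otimes>\<^sub>M lborel)
        (\<lambda>p::real \<times> real. A * (B * C) * indicator ({c..x} \<times> {c..x}) p :: real)"
      by (intro integrable_mult_right)
         (simp add: integrable_indicator_iff lborel.emeasure_pair_measure_Times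
           emeasure_lborel_Icc_eq ennreal_mult_less_top)
    show "case_prod ?f \<in> borel_measurable (lborel \<Otimes>\<^sub>M lborel)" by measurable
    show "AE p in lborel \<Otimes>\<^sub>M lborel. norm (case_prod ?f p)
        \<le> norm (A * (B * C) * indicator ({c..x} \<times> {c..x}) p)"
      using bound A(1) B(1) C(1) by (auto simp: abs_mult)
  qed
  then have "(LINT z|lborel. LINT s|lborel. ?f z s) = (LINT s|lborel. LINT z|lborel. ?f z s)"
    by (rule lborel_pair.Fubini_integral[symmetric])
  also have "\<dots> = (LINT s|lborel. conv u v (x - s) * w s)"
  proof (rule Bochner_Integration.integral_cong)
    fix s
    have "(LINT z|lborel. ?f z s) = conv u (\<lambda>z. v (z - s)) x * w s"
      unfolding conv_def by (simp add: mult.assoc[symmetric])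
    then show "(LINT z|lborel. ?f z s) = conv u v (x - s) * w s"
      by (simp add: conv_shift_right)
  qed simp
  finally show ?thesis unfolding conv_def by simp
qed

section \<open>Laplace transforms\<close>

text \<open>The weight factors as \<open>exp (- \<theta> * (x - z)) * exp (- \<theta> * z)\<close>,
  so the weighted convolution is the convolution of the weighted functions, and Fubini turns its
  integral into a product.\<close>

lemma laplace_conv:
  fixes u v :: "real \<Rightarrow> real"
  assumes u: "causal_from 0 u" and v: "causal_from 0 v"
    and iu: "integrable lborel (\<lambda>x. exp (- \<theta> * x) * u x)"
    and iv: "integrable lborel (\<lambda>x. exp (- \<theta> * x) * v x)"
  shows "integrable lborel (\<lambda>x. exp (- \<theta> * x) * conv u v x)" (is ?int)
    and "(LINT x|lborel. exp (- \<theta> * x) * conv u v x) =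
      (LINT x|lborel. exp (- \<theta> * x) * u x) * (LINT x|lborel. exp (- \<theta> * x) * v x)" (is ?eq)
proof -
  note [measurable] = assms(1,2)[THEN causal_from_measurable]
  let ?u = "\<lambda>x. exp (- \<theta> * x) * u x" and ?v = "\<lambda>x. exp (- \<theta> * x) * v x"
  let ?f = "\<lambda>z x. ?u (x - z) * ?v z"
  have shift: "integrable lborel (\<lambda>x. ?u (x - z))" for z
    using lborel_integrable_real_affine[OF iu, of 1 "- z"] by (simp add: algebra_simps)
  have shift_int: "(LINT x|lborel. g (x - z)) = (LINT x|lborel. g x)" for g :: "real \<Rightarrow> real" and z
    by (subst (2) lborel_integral_real_affine[of 1 _ "- z"]) (simp_all add: algebra_simps)
  have int: "integrable (lborel \<Otimes>\<^sub>M lborel) (case_prod ?f)"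
  proof (rule lborel_pair.Fubini_integrable)
    show "case_prod ?f \<in> borel_measurable (lborel \<Otimes>\<^sub>M lborel)" by measurable
    \<comment> \<open>By translation invariance the inner norm integral is a constant times
      \<open>norm (?v z)\<close>, which is integrable in \<open>z\<close>.\<close>
    have "(LINT x|lborel. norm (case_prod ?f (z, x))) = (LINT x|lborel. norm (?u x)) * norm (?v z)" for z
      using shift_int[of "\<lambda>x. norm (?u x)" z] by (simp add: abs_mult)
    then show "integrable lborel (\<lambda>z. LINT x|lborel. norm (case_prod ?f (z, x)))"
      using integrable_norm[OF iv] by simp
    show "AE z in lborel. integrable lborel (\<lambda>x. case_prod ?f (z, x))"
      using shift by simp
  qed
  have inner: "(LINT z|lborel. ?f z x) = exp (- \<theta> * x) * conv u v x" for x
  proof -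
    have "?f z x = exp (- \<theta> * x) * (u (x - z) * v z)" for z
      using mult_exp_exp[of "- \<theta> * (x - z)" "- \<theta> * z"] by (simp add: algebra_simps)
    then show ?thesis by (simp only: conv_def integral_mult_right_zero)
  qed
  show ?int
    using lborel_pair.integrable_snd[OF int] by (simp only: inner)
  have "(LINT x|lborel. exp (- \<theta> * x) * conv u v x) = (LINT z|lborel. LINT x|lborel. ?f z x)"
    unfolding inner[symmetric] by (rule lborel_pair.Fubini_integral[OF int])
  also have "\<dots> = (LINT z|lborel. (LINT x|lborel. ?u x) * ?v z)"
    by (simp only: prod.case integral_mult_left_zero shift_int[of ?u])
  also have "\<dots> = (LINT x|lborel. ?u x) * (LINT x|lborel. ?v x)"
    by simp
  finally show ?eq .
qed

text \<open>A zero integral makes \<open>f\<close> vanish almost everywhere, whereas continuity at a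
  point with \<open>f x \<noteq> 0\<close> would keep \<open>f\<close> nonzero on an interval of
  positive length.\<close>

lemma continuous_nonneg_integral_zero:
  fixes f :: "real \<Rightarrow> real"
  assumes cont: "continuous_on {0..} f" and nonneg: "\<And>x. x \<ge> 0 \<Longrightarrow> f x \<ge> 0"
    and int: "set_integrable lborel {0..} f" and zero: "(LINT x:{0..}|lborel. f x) = 0"
    and x: "x \<ge> 0"
  shows "f x = 0"
proof (rule ccontr)
  assume "f x \<noteq> 0"
  have ae: "AE y in lborel. indicator {0..} y *\<^sub>R f y = 0"
    using integral_nonneg_eq_0_iff_AE[OF int[unfolded set_integrable_def]] nonneg zero
    by (simp add: set_lebesgue_integral_def indicator_def)
  have "(f \<longlongrightarrow> f x) (at x within {0..})"
    using cont x by (auto simp: continuous_on_def)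
  \<comment> \<open>Only the right-hand limit is taken, which treats the boundary point
    \<open>x = 0\<close> like any other.\<close>
  then have "(f \<longlongrightarrow> f x) (at_right x)"
    by (rule tendsto_within_subset) (use x in auto)
  then have "eventually (\<lambda>y. f y \<noteq> 0) (at_right x)"
    using \<open>f x \<noteq> 0\<close> by (rule tendsto_imp_eventually_ne)
  then obtain b where b: "b > x" "\<And>y. x < y \<Longrightarrow> y < b \<Longrightarrow> f y \<noteq> 0"
    by (auto simp: eventually_at_right_field)
  have "AE y in lborel. y \<notin> {x<..<b}"
    using ae by eventually_elim (use b x in auto)
  then have "emeasure lborel {x<..<b} = 0"
    by (subst (asm) AE_iff_measurable[of "{x<..<b}"]) auto
  then show False using b by simp
qed

text \<open>After the substitution \<open>u = exp (- y)\<close> the hypothesis annihilates all polynomials in \<open>u\<close>, hence by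
  Weierstrass all continuous functions on \<open>[0, 1]\<close>. Testing against \<open>u\<close> times the truncation of the
  function itself to \<open>[-1, 1]\<close> leaves a nonnegative integrand.\<close>

lemma laplace_injective_continuous:
  fixes f :: "real \<Rightarrow> real"
  assumes cont: "continuous_on {0..} f"
    and int: "\<And>\<theta>. \<theta> > c \<Longrightarrow> set_integrable lborel {0..} (\<lambda>y. exp (- \<theta> * y) * f y)"
    and zero: "\<And>\<theta>. \<theta> > c \<Longrightarrow> (LINT y:{0..}|lborel. exp (- \<theta> * y) * f y) = 0"
    and x: "x \<ge> 0"
  shows "f x = 0"
proof -
  \<comment> \<open>The shift by \<open>c + 1\<close> makes \<open>g\<close> integrable, and
    multiplying by \<open>exp (- y) ^ k\<close> gives the exponent \<open>c + 1 + k\<close>, still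
    above \<open>c\<close>.\<close>
  define g where "g y = exp (- (c + 1) * y) * f y" for y
  define T where "T y = max (- 1) (min 1 (g y))" for y
  \<comment> \<open>\<open>T (- ln u)\<close> need not converge as \<open>u\<close> tends to 0, but
    it is bounded, so the factor \<open>u\<close> makes \<open>\<phi>\<close> continuous
    there.\<close>
  define \<phi> where "\<phi> u = (if u \<le> 0 then 0 else u * T (- ln u))" for u
  have g_cont: "continuous_on {0..} g"
    unfolding g_def by (intro continuous_intros cont)
  have T_cont: "continuous_on {0..} T"
    unfolding T_def by (intro continuous_intros g_cont)
  have T_bound: "\<bar>T y\<bar> \<le> 1" for y unfolding T_def by auto
  have g_int: "set_integrable lborel {0..} g"
    using int[of "c + 1"] by (simp add: g_def[abs_def])
  have mono: "set_integrable lborel {0..} (\<lambda>y. exp (- y) ^ k * g y)"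
    "(LINT y:{0..}|lborel. exp (- y) ^ k * g y) = 0" for k
  proof -
    have eq: "exp (- y) ^ k * g y = exp (- (c + 1 + real k) * y) * f y" for y
      unfolding g_def exp_of_nat_mult[symmetric] mult.assoc[symmetric] mult_exp_exp
      by (simp add: algebra_simps)
    show "set_integrable lborel {0..} (\<lambda>y. exp (- y) ^ k * g y)"
      "(LINT y:{0..}|lborel. exp (- y) ^ k * g y) = 0"
      unfolding eq using int[of "c + 1 + real k"] zero[of "c + 1 + real k"] by auto
  qed
  have \<phi>_cont: "continuous_on {0..1} \<phi>"
    unfolding continuous_on_eq_continuous_within
  proof
    fix u :: real assume u: "u \<in> {0..1}"
    show "continuous (at u within {0..1}) \<phi>"
    proof (cases "u = 0")
      case True
      have "(\<phi> \<longlongrightarrow> 0) (at 0 within {0..1})"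
      proof (rule Lim_null_comparison)
        show "\<forall>\<^sub>F u in at 0 within {0..1}. norm (\<phi> u) \<le> \<bar>u\<bar>"
          using T_bound by (auto simp: \<phi>_def abs_mult mult_left_le intro!: always_eventually)
        show "((\<lambda>u::real. \<bar>u\<bar>) \<longlongrightarrow> 0) (at 0 within {0..1})"
          by (auto intro!: tendsto_eq_intros)
      qed
      then show ?thesis using True by (simp add: continuous_within \<phi>_def)
    next
      case False
      have "continuous_on {0<..1} (\<lambda>u. u * T (- ln u))"
        by (intro continuous_intros continuous_on_compose2[OF T_cont]) auto
      then have "continuous_on {0<..1} \<phi>"
        by (rule continuous_on_eq) (auto simp: \<phi>_def)
      then have "continuous (at u within {0<..1}) \<phi>"
        using u False by (simp add: continuous_on_eq_continuous_within)
      moreover have "at u within {0..1} = at u within {0<..1}"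
        by (rule at_within_nhd[of _ "{0<..}"]) (use u False in auto)
      ultimately show ?thesis by simp
    qed
  qed
  have comp_cont: "continuous_on {0..} (\<lambda>y. \<phi> (exp (- y)))"
    by (intro continuous_on_compose2[OF \<phi>_cont] continuous_intros) auto
  have \<phi>_bound: "\<bar>\<phi> (exp (- y))\<bar> \<le> 1" if "y \<ge> 0" for y
    using T_bound[of y] that by (simp add: \<phi>_def abs_mult mult_le_one)
  have \<phi>_int: "set_integrable lborel {0..} (\<lambda>y. \<phi> (exp (- y)) * g y)"
  proof (rule set_integrable_bound[OF g_int])
    show "set_borel_measurable lborel {0..} (\<lambda>y. \<phi> (exp (- y)) * g y)"
      unfolding set_borel_measurable_def
      using borel_measurable_continuous_on_indicator[of "{0..}", OF _ continuous_on_mult[OF comp_cont g_cont]]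
      by simp
    show "AE y in lborel. y \<in> {0..} \<longrightarrow> norm (\<phi> (exp (- y)) * g y) \<le> norm (g y)"
      using \<phi>_bound by (auto simp: abs_mult mult_left_le_one_le)
  qed
  \<comment> \<open>Replacing \<open>\<phi>\<close> by a polynomial within \<open>e\<close> costs at
    most \<open>e\<close> times the L1 norm of \<open>g\<close>, and the polynomial integrates to 0
    against \<open>g\<close>.\<close>
  have small: "\<bar>LINT y:{0..}|lborel. \<phi> (exp (- y)) * g y\<bar> \<le> e * (LINT y:{0..}|lborel. \<bar>g y\<bar>)"
    if e: "e > 0" for e
  proof -
    obtain P where P: "real_polynomial_function P" "\<And>u. u \<in> {0..1} \<Longrightarrow> \<bar>\<phi> u - P u\<bar> < e"
      using Stone_Weierstrass_real_polynomial_function[OF _ \<phi>_cont e] by auto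
    obtain a m where am: "P = (\<lambda>u. \<Sum>i\<le>m. a i * u ^ i)"
      using P(1) by (auto simp: real_polynomial_function_iff_sum)
    have Pg: "P (exp (- y)) * g y = (\<Sum>i\<le>m. a i * (exp (- y) ^ i * g y))" for y
      unfolding am sum_distrib_right by (simp add: mult.assoc)
    have terms: "integrable lborel (\<lambda>y. indicator {0..} y *\<^sub>R (a i * (exp (- y) ^ i * g y)))" for i
      using set_integrable_mult_right[OF mono(1), of "a i" i] by (simp add: set_integrable_def)
    have P_int: "set_integrable lborel {0..} (\<lambda>y. P (exp (- y)) * g y)"
      unfolding Pg set_integrable_def scaleR_sum_right
      by (intro Bochner_Integration.integrable_sum terms)
    have "(LINT y:{0..}|lborel. P (exp (- y)) * g y) = (\<Sum>i\<le>m. LINT y:{0..}|lborel. a i * (exp (- y) ^ i * g y))"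
      unfolding Pg set_lebesgue_integral_def scaleR_sum_right
      by (intro Bochner_Integration.integral_sum terms)
    also have "\<dots> = 0" using mono(2) by simp
    finally have P0: "(LINT y:{0..}|lborel. P (exp (- y)) * g y) = 0" .
    have diff_int: "set_integrable lborel {0..} (\<lambda>y. \<phi> (exp (- y)) * g y - P (exp (- y)) * g y)"
      by (rule set_integral_diff(1)[OF \<phi>_int P_int])
    have "\<bar>LINT y:{0..}|lborel. \<phi> (exp (- y)) * g y\<bar>
        = norm (LINT y:{0..}|lborel. \<phi> (exp (- y)) * g y - P (exp (- y)) * g y)"
      using set_integral_diff(2)[OF \<phi>_int P_int] P0 by simp
    also have "\<dots> \<le> (LINT y:{0..}|lborel. norm (\<phi> (exp (- y)) * g y - P (exp (- y)) * g y))"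
      by (rule set_integral_norm_bound[OF diff_int])
    also have "\<dots> \<le> (LINT y:{0..}|lborel. e * \<bar>g y\<bar>)"
    proof (rule set_integral_mono)
      show "set_integrable lborel {0..} (\<lambda>y. norm (\<phi> (exp (- y)) * g y - P (exp (- y)) * g y))"
        by (rule set_integrable_norm[OF diff_int])
      show "set_integrable lborel {0..} (\<lambda>y. e * \<bar>g y\<bar>)"
        by (intro set_integrable_mult_right set_integrable_abs g_int)
      show "norm (\<phi> (exp (- y)) * g y - P (exp (- y)) * g y) \<le> e * \<bar>g y\<bar>" if "y \<in> {0..}" for y
        using P(2)[of "exp (- y)"] that
        by (simp add: left_diff_distrib[symmetric] abs_mult mult_right_mono)
    qed
    finally show ?thesis by simp
  qed
  have \<phi>_zero: "(LINT y:{0..}|lborel. \<phi> (exp (- y)) * g y) = 0"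
  proof (rule ccontr)
    define I where "I = \<bar>LINT y:{0..}|lborel. \<phi> (exp (- y)) * g y\<bar>"
    define G where "G = (LINT y:{0..}|lborel. \<bar>g y\<bar>)"
    assume "\<not> ?thesis"
    then have I: "I > 0" by (simp add: I_def)
    have G: "G \<ge> 0" unfolding G_def set_lebesgue_integral_def by (intro integral_nonneg_AE) auto
    \<comment> \<open>The tolerance \<open>I / (2 * (G + 1))\<close> leaves less than half of
      \<open>I\<close>; the \<open>+ 1\<close> keeps it well defined when
      \<open>G = 0\<close>.\<close>
    have "I \<le> I / (2 * (G + 1)) * G"
      using small[of "I / (2 * (G + 1))"] I G by (simp add: I_def G_def)
    moreover have "I / (2 * (G + 1)) * G < I"
      using I G by (simp add: field_simps add_nonneg_pos)
    ultimately show False by simp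
  qed
  have "\<phi> (exp (- x)) * g x = 0"
  proof (rule continuous_nonneg_integral_zero[OF _ _ \<phi>_int \<phi>_zero x])
    show "continuous_on {0..} (\<lambda>y. \<phi> (exp (- y)) * g y)"
      by (intro continuous_intros comp_cont g_cont)
    show "\<phi> (exp (- y)) * g y \<ge> 0" for y
    proof -
      \<comment> \<open>Truncation to [-1, 1] preserves the sign.\<close>
      have "T y * g y \<ge> 0" unfolding T_def by (cases "g y \<ge> 0") (auto intro: mult_nonneg_nonneg mult_nonpos_nonpos)
      then show ?thesis by (simp add: \<phi>_def mult.assoc)
    qed
  qed
  then have "T x = 0 \<or> g x = 0" by (simp add: \<phi>_def)
  then have "g x = 0" by (auto simp: T_def max_def min_def split: if_splits)
  then show ?thesis by (simp add: g_def)
qed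

text \<open>A causal \<open>u\<close> can jump only at 0, so along \<open>s n\<close> tending to
  \<open>x\<close> the integrands converge for every \<open>z \<noteq> x\<close>. This exceptional
  point is null, and dominated convergence gives continuity on the whole line.\<close>

lemma continuous_on_conv:
  assumes u: "causal_from 0 u" "continuous_on {0..} u" and v: "causal_from c v"
  shows "continuous_on UNIV (conv u v)"
  unfolding continuous_on_sequentially
proof (intro allI impI ballI, elim conjE)
  fix s :: "nat \<Rightarrow> real" and x assume s: "s \<longlonglongrightarrow> x"
  note [measurable] = u(1)[THEN causal_from_measurable] v[THEN causal_from_measurable]
  have u_cont: "isCont u t" if "t \<noteq> 0" for t
  proof (cases "t > 0")
    case True
    then show ?thesis using continuous_on_interior[OF u(2), of t] by simp
  next
    case False
    have "\<forall>\<^sub>F r in nhds t. u r = 0"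
      using eventually_nhds_in_open[of "{..<0}" t] False that
      by (auto elim!: eventually_mono simp: causal_from_zero[OF u(1)])
    then show ?thesis by (simp add: isCont_cong)
  qed
  obtain b where b: "\<And>n. s n \<le> b"
    using convergent_imp_Bseq[of s] s by (auto simp: convergent_def Bseq_def abs_le_iff)
  obtain B where B: "\<And>x z. x \<le> b \<Longrightarrow> \<bar>u (x - z) * v z\<bar> \<le> B * indicator {c..b - 0} z"
    using conv_bound[OF u(1) v] by metis
  have "(\<lambda>n. conv u v (s n)) \<longlonglongrightarrow> conv u v x"
    unfolding conv_def
  proof (rule integral_dominated_convergence)
    show "integrable lborel (\<lambda>z. B * indicator {c..b - 0} z :: real)"
      by (rule integrable_indicator_Icc)
    show "AE z in lborel. (\<lambda>n. u (s n - z) * v z) \<longlonglongrightarrow> u (x - z) * v z"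
      using AE_lborel_singleton[of x]
    proof eventually_elim
      case (elim z)
      have "(\<lambda>n. u (s n - z)) \<longlonglongrightarrow> u (x - z)"
        by (rule isCont_tendsto_compose[OF u_cont]) (use elim s in \<open>auto intro!: tendsto_intros\<close>)
      then show ?case by (intro tendsto_intros)
    qed
    show "AE z in lborel. norm (u (s n - z) * v z) \<le> B * indicator {c..b - 0} z" for n
      using B[OF b] by simp
  qed measurable
  then show "(conv u v \<circ> s) \<longlonglongrightarrow> conv u v x" by (simp add: o_def)
qed

section \<open>Scale functions\<close>

text \<open>Vanishing on the negative half-line and nonnegativity extend monotonicity to the whole
  line, which gives measurability and the bound \<open>W b\<close> on the half-line up to
  \<open>b\<close>.\<close>

lemma scale_function_causal:
  assumes "is_scale_function \<psi> q W"
  shows "causal_from 0 W"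
proof (rule causal_fromI)
  have W: "\<And>x. 0 \<le> W x" "\<And>x. x < 0 \<Longrightarrow> W x = 0" "mono_on {0..} W"
    using assms by (auto simp: is_scale_function_def)
  have "mono W"
  proof
    fix x y :: real assume "x \<le> y"
    then show "W x \<le> W y" using W(1)[of y] W(2)[of x] mono_onD[OF W(3), of x y] by (cases "x < 0") auto
  qed
  then show "W \<in> borel_measurable borel" by (rule borel_measurable_mono)
  show "W x = 0" if "x < 0" for x using W(2) that .
  show "\<exists>B. \<forall>x\<le>b. \<bar>W x\<bar> \<le> B" for b
    using W(1) monoD[OF \<open>mono W\<close>, of _ b] by (intro exI[of _ "W b"]) simp
qed

lemma set_lebesgue_integral_causal:
  fixes f :: "real \<Rightarrow> real"
  assumes "\<And>x. x < 0 \<Longrightarrow> f x = 0"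
  shows "(LINT x:{0..}|lborel. f x) = (LINT x|lborel. f x)"
    and "set_integrable lborel {0..} f \<longleftrightarrow> integrable lborel f"
proof -
  have "indicator {0..} x *\<^sub>R f x = f x" for x
    using assms[of x] by (auto simp: indicator_def)
  then show "(LINT x:{0..}|lborel. f x) = (LINT x|lborel. f x)"
    "set_integrable lborel {0..} f \<longleftrightarrow> integrable lborel f"
    by (simp_all only: set_lebesgue_integral_def set_integrable_def)
qed

lemma scale_function_laplace:
  assumes W: "is_scale_function \<psi> q W" and \<theta>: "\<theta> > right_inverse \<psi> q"
  shows "integrable lborel (\<lambda>x. exp (- \<theta> * x) * W x)"
    and "(LINT x|lborel. exp (- \<theta> * x) * W x) = 1 / (\<psi> \<theta> - q)"
  using assms set_lebesgue_integral_causal[of "\<lambda>x. exp (- \<theta> * x) * W x"]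
  by (auto simp: is_scale_function_def)

text \<open>If the transform of the \<open>q\<close>-scale function were the junk value \<open>1 / 0 = 0\<close> anywhere, then this
  scale function would vanish and \<open>\<psi> = q\<close> near infinity, which would make the transform of the
  nonnegative \<open>(q + 1)\<close>-scale function equal to \<open>-1\<close>.\<close>

lemma laplace_exponent_neq:
  assumes W: "is_scale_function \<psi> q W" and W': "is_scale_function \<psi> (q + 1) W'"
    and \<theta>: "\<theta> > right_inverse \<psi> q"
  shows "\<psi> \<theta> \<noteq> q"
proof
  assume eq: "\<psi> \<theta> = q"
  have nonneg: "\<And>x. 0 \<le> W x" "\<And>x. 0 \<le> W' x"
    and cont: "continuous_on {0..} W"
    using assms by (auto simp: is_scale_function_def)
  have "exp (- \<theta> * x) * W x = 0" if "x \<ge> 0" for x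
  proof (rule continuous_nonneg_integral_zero[OF _ _ _ _ that])
    show "continuous_on {0..} (\<lambda>x. exp (- \<theta> * x) * W x)"
      by (intro continuous_intros cont)
  qed (use W \<theta> eq nonneg in \<open>auto simp: is_scale_function_def\<close>)
  then have W0: "W x = 0" for x
    using causal_from_zero[OF scale_function_causal[OF W], of x] by (cases "x < 0") auto
  \<comment> \<open>A point where both transforms are available. There
    \<open>1 / (\<psi> \<theta>' - q) = 0\<close> means \<open>\<psi> \<theta>' = q\<close>, since
    division by zero yields 0.\<close>
  define \<theta>' where "\<theta>' = max (right_inverse \<psi> q) (right_inverse \<psi> (q + 1)) + 1"
  have "1 / (\<psi> \<theta>' - q) = 0"
    using scale_function_laplace(2)[OF W, of \<theta>'] by (simp add: W0 \<theta>'_def)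
  then have "(LINT x|lborel. exp (- \<theta>' * x) * W' x) = - 1"
    using scale_function_laplace(2)[OF W', of \<theta>'] by (simp add: \<theta>'_def)
  moreover have "(LINT x|lborel. exp (- \<theta>' * x) * W' x) \<ge> 0"
    by (intro integral_nonneg_AE) (simp add: nonneg)
  ultimately show False by simp
qed

text \<open>On transforms this is the partial fraction identity for
  \<open>1 / (\<psi> - q) - 1 / (\<psi> - p)\<close>. Both sides are continuous on the nonnegative
  half-line, so injectivity of the Laplace transform gives equality at every point.\<close>

lemma scale_function_resolvent:
  assumes W: "\<And>q. q \<ge> 0 \<Longrightarrow> is_scale_function \<psi> q (W q)" and p: "p \<ge> 0" and q: "q \<ge> 0"
  shows "W q x - W p x = (q - p) * conv (W p) (W q) x"
proof (cases "x < 0")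
  case True
  note causal = scale_function_causal[OF W[OF p]] scale_function_causal[OF W[OF q]]
  show ?thesis
    using True causal causal_from_conv[OF causal] by (simp add: causal_from_def)
next
  case False
  let ?c = "max (right_inverse \<psi> p) (right_inverse \<psi> q)"
  define f where "f x = W q x - W p x - (q - p) * conv (W p) (W q) x" for x
  note causal = scale_function_causal[OF W[OF p]] scale_function_causal[OF W[OF q]]
  note causal_conv = causal_from_conv[OF causal]
  have cont: "continuous_on {0..} (W p)" "continuous_on {0..} (W q)"
    using W p q by (auto simp: is_scale_function_def)
  have f_zero: "f x = 0" if "x < 0" for x
    using causal causal_conv that by (simp add: causal_from_def f_def)
  have "f x = 0"
  proof (rule laplace_injective_continuous[where f = f and x = x and c = ?c])
    show "continuous_on {0..} f"
      unfolding f_def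
      by (intro continuous_intros cont continuous_on_subset[OF continuous_on_conv[OF causal(1) cont(1) causal(2)]]) auto
    show "x \<ge> 0" using False by simp
    fix \<theta> assume \<theta>: "\<theta> > ?c"
    let ?L = "\<lambda>u x. exp (- \<theta> * x) * u x"
    have f_eq: "?L f = (\<lambda>x. ?L (W q) x - ?L (W p) x - (q - p) * ?L (conv (W p) (W q)) x)"
      by (simp add: f_def algebra_simps)
    \<comment> \<open>Nonzero denominators are what the partial fraction identity requires.\<close>
    have neq: "\<psi> \<theta> \<noteq> p" "\<psi> \<theta> \<noteq> q"
      using laplace_exponent_neq[OF W W] p q \<theta> by auto
    have int: "integrable lborel (?L (W p))" "integrable lborel (?L (W q))"
      and val: "(LINT x|lborel. ?L (W p) x) = 1 / (\<psi> \<theta> - p)" "(LINT x|lborel. ?L (W q) x) = 1 / (\<psi> \<theta> - q)"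
      using scale_function_laplace[OF W] p q \<theta> by auto
    note conv = laplace_conv[OF causal int]
    have "integrable lborel (?L f)"
      unfolding f_eq by (intro Bochner_Integration.integrable_diff int integrable_mult_right conv(1))
    then show "set_integrable lborel {0..} (?L f)"
      by (subst set_lebesgue_integral_causal(2)) (simp_all only: f_zero mult_zero_right)
    have "(LINT x|lborel. ?L f x)
        = (LINT x|lborel. ?L (W q) x) - (LINT x|lborel. ?L (W p) x)
          - (q - p) * (LINT x|lborel. ?L (conv (W p) (W q)) x)"
      unfolding f_eq using int conv(1)
      by (simp only: Bochner_Integration.integral_diff Bochner_Integration.integrable_diff
          integrable_mult_right integral_mult_right_zero)
    also have "\<dots> = 1 / (\<psi> \<theta> - q) - 1 / (\<psi> \<theta> - p) - (q - p) * (1 / (\<psi> \<theta> - p) * (1 / (\<psi> \<theta> - q)))"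
      by (simp only: conv(2) val)
    also have "\<dots> = 0"
      using neq by (simp add: divide_simps)
    finally have "(LINT x|lborel. ?L f x) = 0" .
    then show "(LINT x:{0..}|lborel. ?L f x) = 0"
      by (subst set_lebesgue_integral_causal(1)) (simp_all only: f_zero mult_zero_right)
  qed
  then show ?thesis by (simp add: f_def)
qed

section \<open>The Volterra equation\<close>

lemma set_lebesgue_integral_conv:
  assumes W: "causal_from 0 W" and f: "causal_from y f"
  shows "(LINT z:{y..x}|lborel. W (x - z) * f z) = conv W f x"
  unfolding conv_def set_lebesgue_integral_def
proof (rule Bochner_Integration.integral_cong)
  show "indicator {y..x} z *\<^sub>R (W (x - z) * f z) = W (x - z) * f z" for z
    using causal_from_zero[OF W, of "x - z"] causal_from_zero[OF f, of z]
    by (cases "z < y \<or> x < z") auto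
qed simp

text \<open>Each integration contributes a factor \<open>1 / Suc m\<close>; these build the
  factorial in the Volterra iteration.\<close>

lemma integral_power_shift:
  assumes "y \<le> x"
  shows "integrable lborel (\<lambda>z::real. (z - y) ^ m * indicator {y..x} z)"
    and "(LINT z|lborel. (z - y) ^ m * indicator {y..x} z) = (x - y) ^ Suc m / Suc m"
proof -
  have "has_bochner_integral lborel (\<lambda>z. (z - y) ^ m * indicator {y..x} z)
      ((x - y) ^ Suc m / Suc m - (y - y) ^ Suc m / Suc m)"
    by (rule has_bochner_integral_FTC_Icc_real[OF assms])
       (auto intro!: derivative_eq_intros simp del: power_Suc of_nat_Suc)
  then show "integrable lborel (\<lambda>z::real. (z - y) ^ m * indicator {y..x} z)"
    "(LINT z|lborel. (z - y) ^ m * indicator {y..x} z) = (x - y) ^ Suc m / Suc m"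
    by (auto simp: has_bochner_integral_iff)
qed

text \<open>Substituting the equation into itself \<open>m\<close> times bounds \<open>g\<close> by
  a constant times the \<open>m\<close>-th term of an exponential series, which tends to 0.\<close>

lemma volterra_homogeneous_zero:
  assumes W: "causal_from 0 W" and \<omega>: "\<omega> \<in> borel_measurable borel" "locally_bounded \<omega>"
    and g: "causal_from y g" and eq: "\<And>x. g x = conv W (\<lambda>z. \<omega> z * g z) x"
  shows "g x = 0"
proof (cases "x < y")
  case True
  then show ?thesis using causal_from_zero[OF g] by simp
next
  case False
  obtain B where B: "B \<ge> 0" "\<And>t. t \<le> x - y \<Longrightarrow> \<bar>W t\<bar> \<le> B"
    using causal_from_bound[OF W] by metis
  obtain C where C: "C \<ge> 0" "\<And>t. y \<le> t \<Longrightarrow> t \<le> x \<Longrightarrow> \<bar>\<omega> t\<bar> \<le> C"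
    using locally_boundedE[OF \<omega>(2)] by metis
  obtain K where K: "K \<ge> 0" "\<And>t. t \<le> x \<Longrightarrow> \<bar>g t\<bar> \<le> K"
    using causal_from_bound[OF g] by metis
  let ?h = "\<lambda>z. \<omega> z * g z"
  have h: "causal_from y ?h" by (rule causal_from_mult[OF g \<omega>])
  \<comment> \<open>The constants \<open>B\<close>, \<open>C\<close> and \<open>K\<close> serve all
    \<open>t\<close> between \<open>y\<close> and \<open>x\<close>, so the induction can run over
    \<open>m\<close> with \<open>t\<close> arbitrary.\<close>
  have bound: "\<bar>g t\<bar> \<le> K * (B * C) ^ m * ((t - y) ^ m / fact m)" if "y \<le> t" "t \<le> x" for t m
    using that
  proof (induction m arbitrary: t)
    case 0
    then show ?case using K by simp
  next
    case (Suc m)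
    let ?k = "K * (B * C) ^ Suc m / fact m"
    let ?b = "\<lambda>z. ?k * ((z - y) ^ m * indicator {y..t} z)"
    have "\<bar>conv W ?h t\<bar> \<le> (LINT z|lborel. ?b z)"
      unfolding conv_def real_norm_def[symmetric]
    proof (rule Bochner_Integration.integral_norm_bound_integral[OF conv_integrable[OF W h]])
      show "integrable lborel ?b"
        by (intro integrable_mult_right integral_power_shift Suc.prems)
      fix z
      show "norm (W (t - z) * ?h z) \<le> ?b z"
      proof (cases "z \<in> {y..t}")
        case True
        then have "\<bar>W (t - z) * ?h z\<bar> \<le> B * (C * (K * (B * C) ^ m * ((z - y) ^ m / fact m)))"
          unfolding abs_mult using Suc.prems B(1) C(1)
          by (intro mult_mono B(2) C(2) Suc.IH) auto
        also have "\<dots> = ?b z" using True by simp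
        finally show ?thesis by simp
      next
        case False
        then show ?thesis using causal_from_zero[OF W, of "t - z"] causal_from_zero[OF g, of z] by auto
      qed
    qed
    also have "\<dots> = ?k * ((t - y) ^ Suc m / Suc m)"
      by (simp only: integral_mult_right_zero integral_power_shift(2)[OF Suc.prems(1)])
    also have "\<dots> = K * (B * C) ^ Suc m * ((t - y) ^ Suc m / fact (Suc m))"
      by (simp add: mult_ac)
    finally show ?case using eq[of t] by simp
  qed
  define a where "a = B * C * (x - y)"
  have "\<bar>g x\<bar> \<le> K * (inverse (fact m) * a ^ m)" for m
    using bound[of x m] False by (simp add: a_def power_mult_distrib divide_inverse mult_ac)
  moreover have "(\<lambda>m. K * (inverse (fact m) * a ^ m)) \<longlonglongrightarrow> K * 0"
    by (intro tendsto_intros summable_LIMSEQ_zero summable_exp)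
  ultimately have "\<bar>g x\<bar> \<le> K * 0"
    by (intro LIMSEQ_le_const) auto
  then show ?thesis by simp
qed

text \<open>For \<open>x < y\<close> the integration interval is empty and
  \<open>W (x - y) = 0\<close>, so every solution is causal from \<open>y\<close>, and the set
  integral is then a convolution.\<close>

lemma omega_scale_equation_iff:
  assumes W: "causal_from 0 W" and \<omega>: "\<omega> \<in> borel_measurable borel" "locally_bounded \<omega>"
  shows "omega_scale_equation W \<omega> y f \<longleftrightarrow>
    causal_from y f \<and> (\<forall>x. f x = W (x - y) + conv W (\<lambda>z. \<omega> z * f z) x)"
proof -
  have conv: "(LINT z:{y..x}|lborel. W (x - z) * \<omega> z * f z) = conv W (\<lambda>z. \<omega> z * f z) x"
    if "causal_from y f" for x
    using set_lebesgue_integral_conv[OF W causal_from_mult[OF that \<omega>]] by (simp add: mult.assoc)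
  have "f x = 0" if "omega_scale_equation W \<omega> y f" "x < y" for x
  proof -
    have "f x = W (x - y) + (LINT z:{y..x}|lborel. W (x - z) * \<omega> z * f z)"
      using that(1) unfolding omega_scale_equation_def by blast
    then show ?thesis
      using that(2) causal_from_zero[OF W, of "x - y"] by (simp add: set_lebesgue_integral_def)
  qed
  then have causal: "causal_from y f" if "omega_scale_equation W \<omega> y f"
    using that unfolding omega_scale_equation_def causal_from_def by blast
  show ?thesis
  proof
    assume eq: "omega_scale_equation W \<omega> y f"
    show "causal_from y f \<and> (\<forall>x. f x = W (x - y) + conv W (\<lambda>z. \<omega> z * f z) x)"
      using eq causal[OF eq] unfolding omega_scale_equation_def conv[OF causal[OF eq]] by blast
  next
    assume f: "causal_from y f \<and> (\<forall>x. f x = W (x - y) + conv W (\<lambda>z. \<omega> z * f z) x)"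
    show "omega_scale_equation W \<omega> y f"
      unfolding omega_scale_equation_def conv[OF f[THEN conjunct1]]
      using f unfolding causal_from_def by blast
  qed
qed

text \<open>The difference of two solutions solves the homogeneous equation and so vanishes; hence
  the definite description selects \<open>f\<close>.\<close>

lemma omega_scale_eqI:
  assumes W: "causal_from 0 W" and \<omega>: "\<omega> \<in> borel_measurable borel" "locally_bounded \<omega>"
    and f: "causal_from y f" "\<And>x. f x = W (x - y) + conv W (\<lambda>z. \<omega> z * f z) x"
  shows "omega_scale W \<omega> x y = f x"
proof -
  have "h = f" if "omega_scale_equation W \<omega> y h" for h
  proof
    fix x
    have h: "causal_from y h" "\<And>x. h x = W (x - y) + conv W (\<lambda>z. \<omega> z * h z) x"
      using that unfolding omega_scale_equation_iff[OF W \<omega>] by blast+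
    have neg: "causal_from y (\<lambda>x. - 1 * f x)" by (rule causal_from_cmult[OF f(1)])
    have "h x + - 1 * f x = 0"
    proof (rule volterra_homogeneous_zero[OF W \<omega> causal_from_add[OF h(1) neg]])
      fix x
      have "conv W (\<lambda>z. \<omega> z * (h z + - 1 * f z)) x
          = conv W (\<lambda>z. \<omega> z * h z + - 1 * (\<omega> z * f z)) x"
        by (simp add: algebra_simps)
      also have "\<dots> = conv W (\<lambda>z. \<omega> z * h z) x + - 1 * conv W (\<lambda>z. \<omega> z * f z) x"
        unfolding conv_cmult_right[symmetric]
        by (rule conv_add_right[OF W causal_from_mult[OF h(1) \<omega>]
              causal_from_cmult[OF causal_from_mult[OF f(1) \<omega>]]])
      finally show "h x + - 1 * f x = conv W (\<lambda>z. \<omega> z * (h z + - 1 * f z)) x"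
        using h(2)[of x] f(2)[of x] by linarith
    qed
    then show "h x = f x" by simp
  qed
  moreover have "omega_scale_equation W \<omega> y f"
    unfolding omega_scale_equation_iff[OF W \<omega>] using f by blast
  ultimately have "(THE f. omega_scale_equation W \<omega> y f) = f" by blast
  then show ?thesis by (simp add: omega_scale_def)
qed

section \<open>Step rates\<close>

lemma step_rate_Suc:
  "step_rate (Suc k) p \<xi> x = step_rate k p \<xi> x + (p (Suc k) - p k) * indicator {\<xi> (Suc k)<..} x"
  by (simp add: step_rate_def)

text \<open>Beyond all thresholds every indicator is 1 and the sum telescopes.\<close>

lemma step_rate_above:
  assumes "\<And>j. 1 \<le> j \<Longrightarrow> j \<le> k \<Longrightarrow> \<xi> j < x"
  shows "step_rate k p \<xi> x = p k"
  using assms by (induction k) (simp_all add: step_rate_def)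

lemma step_rate_measurable: "step_rate n p \<xi> \<in> borel_measurable borel"
  unfolding step_rate_def[abs_def] by measurable

lemma step_rate_locally_bounded: "locally_bounded (step_rate n p \<xi>)"
proof (rule locally_boundedI)
  have "\<bar>step_rate n p \<xi> x\<bar> \<le> \<bar>p 0\<bar> + (\<Sum>j=1..n. \<bar>p j - p (j - 1)\<bar>)" for x
    unfolding step_rate_def
    by (intro order_trans[OF abs_triangle_ineq] add_left_mono order_trans[OF sum_abs] sum_mono)
       (auto simp: indicator_def)
  then show "\<exists>B. \<forall>x. \<bar>x\<bar> \<le> b \<longrightarrow> \<bar>step_rate n p \<xi> x\<bar> \<le> B" for b by blast
qed

text \<open>Opening the left end of the interval changes a null set, and causality of the scale
  function absorbs the upper limit \<open>x\<close>. The indicator is now the one occurring in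
  \<open>step_rate\<close>.\<close>

lemma iterated_scale_Suc_conv:
  assumes W: "causal_from 0 (W (p (Suc k)))" and f: "causal_from y (\<lambda>x. iterated_scale W p \<xi> k x y)"
  shows "iterated_scale W p \<xi> (Suc k) x y = iterated_scale W p \<xi> k x y +
    (p (Suc k) - p k) * conv (W (p (Suc k)))
      (\<lambda>z. indicator {\<xi> (Suc k)<..} z * iterated_scale W p \<xi> k z y) x"
proof -
  note [measurable] = W[THEN causal_from_measurable] f[THEN causal_from_measurable]
  have "(LINT z:{\<xi> (Suc k)..x}|lborel. W (p (Suc k)) (x - z) * iterated_scale W p \<xi> k z y)
      = conv (W (p (Suc k))) (\<lambda>z. indicator {\<xi> (Suc k)<..} z * iterated_scale W p \<xi> k z y) x"
    unfolding conv_def set_lebesgue_integral_def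
  proof (rule integral_cong_AE)
    show "AE z in lborel.
        indicator {\<xi> (Suc k)..x} z *\<^sub>R (W (p (Suc k)) (x - z) * iterated_scale W p \<xi> k z y) =
        W (p (Suc k)) (x - z) * (indicator {\<xi> (Suc k)<..} z * iterated_scale W p \<xi> k z y)"
      using AE_lborel_singleton[of "\<xi> (Suc k)"]
    proof eventually_elim
      case (elim z)
      then show ?case
        using causal_from_zero[OF W, of "x - z"] by (cases "x < z") (auto simp: indicator_def)
    qed
  qed measurable
  then show ?thesis by simp
qed

text \<open>Induction on the number of thresholds: each recursion step turns a solution for the old
  rate into one for the new rate, always relative to the same kernel \<open>W 0\<close>.\<close>

lemma iterated_scale_equation:
  fixes W :: "real \<Rightarrow> real \<Rightarrow> real"
  assumes W: "\<And>q. q \<ge> 0 \<Longrightarrow> causal_from 0 (W q)"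
    and resolvent: "\<And>q x. q \<ge> 0 \<Longrightarrow> W q x - W 0 x = q * conv (W 0) (W q) x"
    and p: "\<And>j. j \<le> k \<Longrightarrow> p j \<ge> 0" and \<xi>: "mono_on {1..k} \<xi>"
  shows "causal_from y (\<lambda>x. iterated_scale W p \<xi> k x y) \<and>
    (\<forall>x. iterated_scale W p \<xi> k x y =
      W 0 (x - y) + conv (W 0) (\<lambda>z. step_rate k p \<xi> z * iterated_scale W p \<xi> k z y) x)"
  using p \<xi>
proof (induction k)
  case 0
  have causal: "causal_from y (\<lambda>x. W (p 0) (x - y))"
    using causal_from_shift[OF W[OF 0(1)], of 0 y] by simp
  \<comment> \<open>For a constant rate the equation is the resolvent identity translated by
    \<open>y\<close>.\<close>
  have eq: "W (p 0) (x - y) = W 0 (x - y) + conv (W 0) (\<lambda>z. p 0 * W (p 0) (z - y)) x" for x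
    using resolvent[OF 0(1), of 0 "x - y"] by (simp add: conv_cmult_right conv_shift_right)
  have rate: "step_rate 0 p \<xi> z = p 0" for z by (simp add: step_rate_def)
  show ?case
    unfolding iterated_scale.simps rate by (intro conjI allI causal) (rule eq)
next
  case (Suc k)
  define f where "f x = iterated_scale W p \<xi> k x y" for x
  define q where "q = p (Suc k)"
  define c where "c = q - p k"
  define h where "h z = indicator {\<xi> (Suc k)<..} z * f z" for z
  have "causal_from y (\<lambda>x. iterated_scale W p \<xi> k x y) \<and>
    (\<forall>x. iterated_scale W p \<xi> k x y =
      W 0 (x - y) + conv (W 0) (\<lambda>z. step_rate k p \<xi> z * iterated_scale W p \<xi> k z y) x)"
  proof (rule Suc.IH)
    show "mono_on {1..k} \<xi>"
      by (rule mono_on_subset[OF Suc.prems(2)]) simp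
  qed (use Suc.prems(1) in simp)
  then have f: "causal_from y f" "\<And>x. f x = W 0 (x - y) + conv (W 0) (\<lambda>z. step_rate k p \<xi> z * f z) x"
    unfolding f_def[abs_def] by blast+
  have q: "q \<ge> 0" using Suc.prems(1) by (simp add: q_def)
  note W0 = W[OF order.refl] and Wq = W[OF q]
  have h: "causal_from y h"
    unfolding h_def[abs_def]
    by (intro causal_from_mult f locally_boundedI exI[of _ 1]) (auto simp: indicator_def)
  have Wqh: "causal_from y (conv (W q) h)" using causal_from_conv[OF Wq h] by simp
  have F: "iterated_scale W p \<xi> (Suc k) x y = f x + c * conv (W q) h x" for x
    using iterated_scale_Suc_conv[of W p k y \<xi> x] Wq f(1)
    unfolding q_def c_def f_def h_def by auto
  \<comment> \<open>\<open>h\<close> lives strictly to the right of the new threshold, so the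
    correction is never multiplied by one of the earlier rates.\<close>
  have below: "conv (W q) h z = 0" if "z \<le> \<xi> (Suc k)" for z
  proof -
    have "W q (z - s) * h s = 0" for s
      using that causal_from_zero[OF Wq, of "z - s"] by (cases "s \<le> z") (auto simp: h_def)
    then show ?thesis unfolding conv_def by (simp only: Bochner_Integration.integral_zero)
  qed
  \<comment> \<open>Up to the threshold the rates agree and \<open>h\<close> and the correction
    vanish. Beyond it the ordering of the thresholds makes the rates \<open>p k\<close> and
    \<open>q\<close>, while \<open>h = f\<close> and \<open>c = q - p k\<close>.\<close>
  have rate: "step_rate (Suc k) p \<xi> z * (f z + c * conv (W q) h z)
      = step_rate k p \<xi> z * f z + (c * h z + (c * q) * conv (W q) h z)" for z
  proof (cases "z \<le> \<xi> (Suc k)")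
    case True
    then show ?thesis by (simp add: below step_rate_Suc h_def)
  next
    case False
    have "\<xi> j < z" if "1 \<le> j" "j \<le> Suc k" for j
      using mono_onD[OF Suc.prems(2), of j "Suc k"] that False by auto
    then have "step_rate k p \<xi> z = p k" "step_rate (Suc k) p \<xi> z = q"
      by (auto simp: q_def intro!: step_rate_above)
    then show ?thesis using False by (simp add: h_def c_def algebra_simps)
  qed
  \<comment> \<open>The resolvent identity convolved with \<open>h\<close>, after
    reassociating.\<close>
  have q_conv: "q * conv (W 0) (conv (W q) h) x = conv (W q) h x - conv (W 0) h x" for x
  proof -
    have "q * conv (W 0) (conv (W q) h) x = conv (\<lambda>z. q * conv (W 0) (W q) z) h x"
      by (simp only: conv_assoc[OF W0 Wq h] conv_cmult_left)
    also have "\<dots> = conv (\<lambda>z. W q z - W 0 z) h x"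
      by (simp only: resolvent[OF q])
    also have "\<dots> = conv (W q) h x - conv (W 0) h x"
      by (rule conv_diff_left[OF Wq W0 h])
    finally show ?thesis .
  qed
  \<comment> \<open>By \<open>rate\<close> and linearity the right-hand side gains \<open>c\<close>
    times the sum of \<open>conv (W 0) h\<close> and \<open>q * conv (W 0) (conv (W q) h)\<close>;
    by \<open>q_conv\<close> this sum is \<open>conv (W q) h\<close>.\<close>
  have "f x + c * conv (W q) h x
      = W 0 (x - y) + conv (W 0) (\<lambda>z. step_rate (Suc k) p \<xi> z * (f z + c * conv (W q) h z)) x" for x
  proof -
    have \<omega>f: "causal_from y (\<lambda>z. step_rate k p \<xi> z * f z)"
      by (intro causal_from_mult f step_rate_measurable step_rate_locally_bounded)
    have "conv (W 0) (\<lambda>z. step_rate (Suc k) p \<xi> z * (f z + c * conv (W q) h z)) x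
        = conv (W 0) (\<lambda>z. step_rate k p \<xi> z * f z) x
          + (c * conv (W 0) h x + c * q * conv (W 0) (conv (W q) h) x)"
      unfolding rate
      by (simp only: conv_add_right[OF W0 \<omega>f causal_from_add[OF causal_from_cmult[OF h] causal_from_cmult[OF Wqh]]]
          conv_add_right[OF W0 causal_from_cmult[OF h] causal_from_cmult[OF Wqh]] conv_cmult_right)
    also have "\<dots> = f x - W 0 (x - y) + c * conv (W q) h x"
      using f(2)[of x] by (simp add: mult.assoc q_conv right_diff_distrib)
    finally show ?thesis by simp
  qed
  moreover have "causal_from y (\<lambda>x. f x + c * conv (W q) h x)"
    by (intro causal_from_add causal_from_cmult f Wqh)
  ultimately show ?case unfolding F by blast
qed

theorem mainTheorem9:
  fixes M :: "'a measure" and X :: "real \<Rightarrow> 'a \<Rightarrow> real"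
    and \<psi> :: "real \<Rightarrow> real" and W :: "real \<Rightarrow> real \<Rightarrow> real"
    and n :: nat and p \<xi> :: "nat \<Rightarrow> real"
  assumes "spectrally_negative_levy M X"
    and "is_laplace_exponent M X \<psi>"
    and "\<And>q. q \<ge> 0 \<Longrightarrow> is_scale_function \<psi> q (W q)"
    and "n \<ge> 1"
    and "\<And>j. j \<le> n \<Longrightarrow> p j \<ge> 0"
    and "mono_on {1..n} \<xi>"
  shows "\<forall>x y. omega_scale (W 0) (step_rate n p \<xi>) x y = iterated_scale W p \<xi> n x y"
proof (intro allI)
  fix x y
  have causal: "causal_from 0 (W q)" if "q \<ge> 0" for q
    using scale_function_causal[OF assms(3)[OF that]] .
  have resolvent: "W q x - W 0 x = q * conv (W 0) (W q) x" if "q \<ge> 0" for q x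
    using scale_function_resolvent[OF assms(3) order.refl that] by simp
  have eq: "causal_from y (\<lambda>x. iterated_scale W p \<xi> n x y) \<and>
    (\<forall>x. iterated_scale W p \<xi> n x y =
      W 0 (x - y) + conv (W 0) (\<lambda>z. step_rate n p \<xi> z * iterated_scale W p \<xi> n z y) x)"
    by (rule iterated_scale_equation[OF causal resolvent assms(5,6)])
  show "omega_scale (W 0) (step_rate n p \<xi>) x y = iterated_scale W p \<xi> n x y"
    by (rule omega_scale_eqI[OF causal[OF order.refl] step_rate_measurable step_rate_locally_bounded
          eq[THEN conjunct1] eq[THEN conjunct2, THEN spec]])
qed

end
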